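(* Let $G$ be a finite simple graph and let $-G$ be the signed graph obtained by giving every edge of $G$ sign $-1$ (and adjoining a positive loop at every vertex). Then: (a) $\mathrm{BSTAB}(-G)=\mathrm{BIP}(G)$, where $\mathrm{BIP}(G)=\operatorname{conv}\{\mathbf 1_U: U\subseteq V(G),\ G[U]\text{ is bipartite}\}$; (b) $C(-G)=K_2\mathbin{\Box}G$, the Cartesian product of $K_2$ and $G$ (where $K_2$ has vertex set $\{\pm1\}$ and $(v,s)$ is identified with the pair $s\in V(K_2)$, $v\in V(G)$); (c) $\max\{\mathbf 1^{\mathsf T}x:x\in\mathrm{BTH}(-G)\}=\vartheta(K_2\mathbin{\Box}G)$, where $\vartheta$ is the Lovász theta number; (d) $\mathrm{BQSTAB}(-G)=\{x\in[0,1]^{V(G)}:x(K)\le2\text{ for every clique }K\text{ of }G\}$, where $x(K)=\sum_{v\in K}x_v$.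
   Context: Signed graphs. A signed graph is a pair $\Sigma=(G,\sigma)$ with $G$ a finite graph and $\sigma:E(G)\to\{+1,-1\}$. Positive loops are allowed, negative loops are excluded. A signed graph is balanced if every cycle has positive sign (product of edge signs); a set $B\subseteq V(\Sigma)$ is balanced if the induced signed graph $\Sigma[B]$ is balanced. Conflict graph. For a signed graph $\Sigma$ with a positive loop at every vertex, $C(\Sigma)$ is the ordinary simple graph on $V(\Sigma)\times\{\pm1\}$ with $(u,s)\sim(v,r)$ iff there is an edge $e=uv$ of $\Sigma$ (possibly a loop, $u=v$) with $r=-\sigma(e)s$. In particular $(v,+)\sim(v,-)$ for all $v$. Ordinary bodies. For a finite simple graph $H$: $\mathrm{QSTAB}(H)=\{x\ge0: x(K)\le1\text{ for every clique }K\}$; $\mathrm{TH}(H)=\{x:\exists\, X\text{ symmetric with }\begin{pmatrix} 1 & x^{\mathsf T} \\ x & X \end{pmatrix}\succeq0,\ \operatorname{diag}X=x,\ X_{uv}=0\ (uv\in E(H))\}$. Signed bodies. Let $p:\mathbb R^{V(\Sigma)\times\{\pm1\}}\to\mathbb R^{V(\Sigma)}$, $p(y)_v=y_{(v,+)}+y_{(v,-)}$. Then $\mathrm{BSTAB}(\Sigma)=\operatorname{conv}\{\mathbf 1_B:B\subseteq V(\Sigma)\text{ balanced}\}$, $\mathrm{BTH}(\Sigma)=p(\mathrm{TH}(C(\Sigma)))$, and $\mathrm{BQSTAB}(\Sigma)=p(\mathrm{QSTAB}(C(\Sigma)))$. Lovász theta number of a nonempty graph $H$: $\vartheta(H)=\max\{\langle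 J,Z\rangle: Z\succeq0,\ \operatorname{Tr}Z=1,\ Z_{uv}=0\ (uv\in E(H))\}$, with $J$ the all-ones matrix. *)

theory Defs
  imports "HOL-Analysis.Analysis"
begin

section \<open>Signs\<close>

text \<open>The two-element group \<open>{+1, -1}\<close>, as a type of its own so that \<open>V \<times> {+1, -1}\<close>
  can index coordinates of a Euclidean space.\<close>

datatype sign = SPos | SNeg

lemma UNIV_sign: "(UNIV :: sign set) = {SPos, SNeg}"
  by (auto intro: sign.exhaust)

instance sign :: finite
  by standard (simp add: UNIV_sign)

instantiation sign :: "{comm_monoid_mult, uminus}"
begin
definition one_sign :: sign where "1 = SPos"
definition times_sign :: "sign \<Rightarrow> sign \<Rightarrow> sign" where
  "s * t = (if s = t then SPos else SNeg)"
definition uminus_sign :: "sign \<Rightarrow> sign" where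
  "- s = (case s of SPos \<Rightarrow> SNeg | SNeg \<Rightarrow> SPos)"
instance
proof
  fix a b c :: sign
  show "a * b * c = a * (b * c)" "a * b = b * a" "1 * a = a"
    by (cases a; cases b; cases c; simp add: times_sign_def one_sign_def)+
qed
end


section \<open>Simple graphs\<close>

record 'v graph =
  verts :: "'v set"
  edges :: "'v set set"

definition simple_graph :: "'v graph \<Rightarrow> bool" where
  "simple_graph G \<longleftrightarrow> finite (verts G) \<and>
     (\<forall>e\<in>edges G. \<exists>u\<in>verts G. \<exists>v\<in>verts G. u \<noteq> v \<and> e = {u, v})"

definition induced_graph :: "'v graph \<Rightarrow> 'v set \<Rightarrow> 'v graph" where
  "induced_graph G U = \<lparr>verts = U, edges = {e \<in> edges G. e \<subseteq> U}\<rparr>"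

definition bipartite :: "'v graph \<Rightarrow> bool" where
  "bipartite G \<longleftrightarrow> (\<exists>A B. A \<union> B = verts G \<and> A \<inter> B = {} \<and>
     (\<forall>e\<in>edges G. \<exists>a\<in>A. \<exists>b\<in>B. e = {a, b}))"

definition clique :: "'v graph \<Rightarrow> 'v set \<Rightarrow> bool" where
  "clique G K \<longleftrightarrow> K \<subseteq> verts G \<and> (\<forall>u\<in>K. \<forall>v\<in>K. u \<noteq> v \<longrightarrow> {u, v} \<in> edges G)"

definition map_graph :: "('a \<Rightarrow> 'b) \<Rightarrow> 'a graph \<Rightarrow> 'b graph" where
  "map_graph f G = \<lparr>verts = f ` verts G, edges = (\<lambda>e. f ` e) ` edges G\<rparr>"

definition K2 :: "sign graph" where
  "K2 = \<lparr>verts = {1, - 1}, edges = {{1, - 1}}\<rparr>"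

definition cartesian_product :: "'a graph \<Rightarrow> 'b graph \<Rightarrow> ('a \<times> 'b) graph"  (infixr "\<box>" 70) where
  "G \<box> H =
     \<lparr>verts = verts G \<times> verts H,
      edges = {{(a, b), (a', b')} | a b a' b'.
                 (a = a' \<and> a \<in> verts G \<and> {b, b'} \<in> edges H) \<or>
                 (b = b' \<and> b \<in> verts H \<and> {a, a'} \<in> edges G)}\<rparr>"


section \<open>Signed graphs\<close>

text \<open>The underlying graph may have parallel edges and loops; a loop is an edge with a single end.\<close>

record ('v, 'e) sgraph =
  sverts :: "'v set"
  sedges :: "'e set"
  ends :: "'e \<Rightarrow> 'v set"
  esign :: "'e \<Rightarrow> sign"

definition signed_graph :: "('v, 'e) sgraph \<Rightarrow> bool" where
  "signed_graph \<Sigma> \<longleftrightarrow> finite (sverts \<Sigma>) \<and> finite (sedges \<Sigma>) \<and>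
     (\<forall>e\<in>sedges \<Sigma>. (\<exists>u\<in>sverts \<Sigma>. \<exists>v\<in>sverts \<Sigma>. ends \<Sigma> e = {u, v}) \<and>
        (card (ends \<Sigma> e) = 1 \<longrightarrow> esign \<Sigma> e = 1))"

definition induced_sgraph :: "('v, 'e) sgraph \<Rightarrow> 'v set \<Rightarrow> ('v, 'e) sgraph" where
  "induced_sgraph \<Sigma> B = \<Sigma>\<lparr>sverts := B, sedges := {e \<in> sedges \<Sigma>. ends \<Sigma> e \<subseteq> B}\<rparr>"

text \<open>A cycle is given by its vertices and edges in cyclic order. A loop is a cycle of length 1,
  and two distinct parallel edges form a cycle of length 2.\<close>

definition is_cycle :: "('v, 'e) sgraph \<Rightarrow> 'v list \<Rightarrow> 'e list \<Rightarrow> bool" where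
  "is_cycle \<Sigma> vs es \<longleftrightarrow>
     vs \<noteq> [] \<and> length es = length vs \<and> distinct vs \<and> distinct es \<and>
     set vs \<subseteq> sverts \<Sigma> \<and> set es \<subseteq> sedges \<Sigma> \<and>
     (\<forall>i<length vs. ends \<Sigma> (es ! i) = {vs ! i, vs ! (Suc i mod length vs)})"

definition balanced :: "('v, 'e) sgraph \<Rightarrow> bool" where
  "balanced \<Sigma> \<longleftrightarrow> (\<forall>vs es. is_cycle \<Sigma> vs es \<longrightarrow> prod_list (map (esign \<Sigma>) es) = 1)"

definition balanced_set :: "('v, 'e) sgraph \<Rightarrow> 'v set \<Rightarrow> bool" where
  "balanced_set \<Sigma> B \<longleftrightarrow> B \<subseteq> sverts \<Sigma> \<and> balanced (induced_sgraph \<Sigma> B)"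

definition conflict_graph :: "('v, 'e) sgraph \<Rightarrow> ('v \<times> sign) graph" where
  "conflict_graph \<Sigma> =
     \<lparr>verts = sverts \<Sigma> \<times> {1, - 1},
      edges = {{(u, s), (v, r)} | u s v r.
                 \<exists>e\<in>sedges \<Sigma>. ends \<Sigma> e = {u, v} \<and> r = - (esign \<Sigma> e * s)}\<rparr>"

text \<open>The signed graph \<open>-G\<close>: the edges of \<open>G\<close> are negative, and the singleton \<open>{v}\<close> is the
  positive loop adjoined at \<open>v\<close>.\<close>

definition neg_graph :: "'v graph \<Rightarrow> ('v, 'v set) sgraph" where
  "neg_graph G =
     \<lparr>sverts = verts G,
      sedges = edges G \<union> {{v} | v. v \<in> verts G},
      ends = (\<lambda>e. e),
      esign = (\<lambda>e. if e \<in> edges G then - 1 else 1)\<rparr>"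

lemma signed_graph_neg_graph:
  assumes "simple_graph G"
  shows "signed_graph (neg_graph G)"
proof -
  have "edges G \<subseteq> Pow (verts G)"
    using assms unfolding simple_graph_def by fastforce
  then have "finite (edges G)"
    using assms unfolding simple_graph_def by (meson finite_Pow_iff finite_subset)
  then show ?thesis
    using assms unfolding signed_graph_def simple_graph_def neg_graph_def
    by (fastforce simp: card_insert_if)
qed

lemma simple_graph_conflict_graph:
  assumes "signed_graph \<Sigma>"
  shows "simple_graph (conflict_graph \<Sigma>)"
proof -
  have ne: "s \<noteq> - (1 * s)" for s :: sign
    by (cases s) (simp_all add: one_sign_def times_sign_def uminus_sign_def)
  have all: "s \<in> {1, - 1}" for s :: sign
    by (cases s) (simp_all add: one_sign_def uminus_sign_def)
  show ?thesis
    unfolding simple_graph_def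
  proof (intro conjI ballI)
    show "finite (verts (conflict_graph \<Sigma>))"
      using assms by (simp add: signed_graph_def conflict_graph_def)
  next
    fix d assume "d \<in> edges (conflict_graph \<Sigma>)"
    then obtain u s v r e where e: "e \<in> sedges \<Sigma>" "ends \<Sigma> e = {u, v}"
      and r: "r = - (esign \<Sigma> e * s)" and d: "d = {(u, s), (v, r)}"
      by (auto simp: conflict_graph_def)
    have uv: "u \<in> sverts \<Sigma>" "v \<in> sverts \<Sigma>"
      using assms e unfolding signed_graph_def by (metis insert_iff singletonD)+
    have "(u, s) \<noteq> (v, r)"
      using assms e r ne[of s] by (auto simp: signed_graph_def)
    then show "\<exists>a\<in>verts (conflict_graph \<Sigma>). \<exists>b\<in>verts (conflict_graph \<Sigma>). a \<noteq> b \<and> d = {a, b}"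
      using uv d all by (intro bexI[of _ "(u, s)"] bexI[of _ "(v, r)"]) (auto simp: conflict_graph_def)
  qed
qed


section \<open>Convex bodies\<close>

text \<open>For a vertex set \<open>V\<close> inside a finite type, the spaces of vectors indexed by \<open>V\<close> and of
  matrices indexed by \<open>V \<times> V\<close> are identified with the coordinate subspaces of those
  vectors and matrices that vanish off \<open>V\<close>. In particular \<open>V\<close> may be empty.\<close>

definition vec_on :: "'v::finite set \<Rightarrow> (real ^ 'v) set" where
  "vec_on V = {x. \<forall>v. v \<notin> V \<longrightarrow> x $ v = 0}"

definition mat_on :: "'v::finite set \<Rightarrow> (real ^ 'v ^ 'v) set" where
  "mat_on V = {X. \<forall>u v. u \<notin> V \<or> v \<notin> V \<longrightarrow> X $ u $ v = 0}"

definition indvec :: "'v::finite set \<Rightarrow> real ^ 'v" where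
  "indvec B = (\<chi> v. indicator B v)"

definition psd :: "real ^ 'n::finite ^ 'n \<Rightarrow> bool" where
  "psd M \<longleftrightarrow> transpose M = M \<and> (\<forall>z. 0 \<le> z \<bullet> (M *v z))"

text \<open>The block matrix with rows \<open>(1, x\<^sup>T)\<close> and \<open>(x, X)\<close>; the extra index is \<open>None\<close>.\<close>

definition bordered :: "real ^ 'v::finite \<Rightarrow> real ^ 'v ^ 'v \<Rightarrow> real ^ 'v option ^ 'v option" where
  "bordered x X = (\<chi> i j.
     case i of
       None \<Rightarrow> (case j of None \<Rightarrow> 1 | Some v \<Rightarrow> x $ v)
     | Some u \<Rightarrow> (case j of None \<Rightarrow> x $ u | Some v \<Rightarrow> X $ u $ v))"

definition QSTAB :: "'v::finite graph \<Rightarrow> (real ^ 'v) set" where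
  "QSTAB H = {x \<in> vec_on (verts H).
     (\<forall>v\<in>verts H. 0 \<le> x $ v) \<and> (\<forall>K. clique H K \<longrightarrow> (\<Sum>v\<in>K. x $ v) \<le> 1)}"

definition TH :: "'v::finite graph \<Rightarrow> (real ^ 'v) set" where
  "TH H = {x \<in> vec_on (verts H). \<exists>X \<in> mat_on (verts H).
     transpose X = X \<and> psd (bordered x X) \<and>
     (\<forall>v\<in>verts H. X $ v $ v = x $ v) \<and>
     (\<forall>u v. {u, v} \<in> edges H \<longrightarrow> X $ u $ v = 0)}"

definition pair_sum :: "real ^ ('v::finite \<times> sign) \<Rightarrow> real ^ 'v" where
  "pair_sum y = (\<chi> v. y $ (v, 1) + y $ (v, - 1))"

definition BSTAB :: "('v::finite, 'e) sgraph \<Rightarrow> (real ^ 'v) set" where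
  "BSTAB \<Sigma> = convex hull {indvec B | B. balanced_set \<Sigma> B}"

definition BTH :: "('v::finite, 'e) sgraph \<Rightarrow> (real ^ 'v) set" where
  "BTH \<Sigma> = pair_sum ` TH (conflict_graph \<Sigma>)"

definition BQSTAB :: "('v::finite, 'e) sgraph \<Rightarrow> (real ^ 'v) set" where
  "BQSTAB \<Sigma> = pair_sum ` QSTAB (conflict_graph \<Sigma>)"

definition BIP :: "'v::finite graph \<Rightarrow> (real ^ 'v) set" where
  "BIP G = convex hull {indvec U | U. U \<subseteq> verts G \<and> bipartite (induced_graph G U)}"


section \<open>Maxima and the theta number\<close>

definition is_max :: "real set \<Rightarrow> real \<Rightarrow> bool" where
  "is_max S m \<longleftrightarrow> m \<in> S \<and> (\<forall>s\<in>S. s \<le> m)"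

text \<open>\<open>(\<chi> u v. 1) \<bullet> Z\<close> is the entrywise inner product of \<open>Z\<close> with the all-ones matrix.
  The maximum exists when \<open>H\<close> has at least one vertex; otherwise the feasible set is empty
  and the value is unspecified.\<close>

definition lovasz_theta :: "'v::finite graph \<Rightarrow> real" where
  "lovasz_theta H = (THE m. is_max
     {(\<chi> u v. 1) \<bullet> Z | Z. Z \<in> mat_on (verts H) \<and> psd Z \<and> trace Z = 1 \<and>
        (\<forall>u v. {u, v} \<in> edges H \<longrightarrow> Z $ u $ v = 0)} m)"

end

theory Submission imports Defs begin

text \<open>For (a), a cycle of \<open>-G\<close> other than a loop has sign \<open>(-1)\<close> to its length, so balance
  of a vertex set means that it spans no odd cycle, and a shortest odd closed walk is an odd cycle.
  For (c), \<open>1\<^sup>T p(y) = 1\<^sup>T y\<close>, so the claim is that \<open>\<vartheta>\<close> maximises \<open>1\<^sup>T y\<close> over \<open>TH(C(-G))\<close>: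
  a witness \<open>(x, X)\<close> of \<open>TH\<close> is rescaled to \<open>X / 1\<^sup>T x\<close>, and an optimal \<open>Z\<close> with value \<open>m\<close>
  yields \<open>x\<^sub>u = (Z1)\<^sub>u\<^sup>2 / (m Z\<^sub>u\<^sub>u)\<close>. For (d), a clique of the prism is either contained in one layer or
  is a rung \<open>{(v,+), (v,-)}\<close>, so the preimage \<open>y(v,s) = x\<^sub>v / 2\<close> works.\<close>

section \<open>The conflict graph\<close>

lemma sign_simps:
  "(- 1 :: sign) \<noteq> 1" "(1 :: sign) \<noteq> - 1" "- (- s) = (s :: sign)" "- 1 * s = - (s :: sign)"
  "- s \<noteq> (s :: sign)" "s \<noteq> - (s :: sign)"
  by (cases s; simp add: one_sign_def times_sign_def uminus_sign_def)+

lemma sign_cases: "s = 1 \<or> s = (- 1 :: sign)"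
  by (cases s) (simp_all add: one_sign_def uminus_sign_def)

lemma UNIV_sign_one: "(UNIV :: sign set) = {1, - 1}"
  using sign_cases by auto

lemma simple_graph_no_loop: "simple_graph G \<Longrightarrow> {v} \<notin> edges G"
  unfolding simple_graph_def by (metis doubleton_eq_iff insert_absorb2)

text \<open>A negative edge gives \<open>r = s\<close>, hence a copy of \<open>G\<close> in each
  layer; the positive loop at \<open>v\<close> gives \<open>r = - s\<close>, hence a rung. As
  \<open>G\<close> is loopless, no \<open>{v}\<close> lies in \<open>edges G\<close>, so each
  adjoined loop really has sign \<open>1\<close>.\<close>

lemma edges_conflict_neg_graph:
  assumes "simple_graph G"
  shows "edges (conflict_graph (neg_graph G)) =
    {{(u, s), (v, r)} | u s v r. ({u, v} \<in> edges G \<and> s = r) \<or> (u = v \<and> u \<in> verts G \<and> r = - s)}"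
proof -
  have "(\<exists>e\<in>sedges (neg_graph G). ends (neg_graph G) e = {u, v} \<and> r = - (esign (neg_graph G) e * s))
    \<longleftrightarrow> ({u, v} \<in> edges G \<and> s = r) \<or> (u = v \<and> u \<in> verts G \<and> r = - s)" for u v s r
    using simple_graph_no_loop[OF assms]
    by (auto simp: neg_graph_def sign_simps split: if_splits)
  then show ?thesis
    by (simp add: conflict_graph_def)
qed

text \<open>The adjacency condition is invariant under exchanging \<open>(u, s)\<close> and
  \<open>(v, r)\<close>, so it may be read off any presentation of the unordered pair.\<close>

lemma conflict_neg_graph_adj:
  assumes "simple_graph G"
  shows "{(u, s), (v, r)} \<in> edges (conflict_graph (neg_graph G)) \<longleftrightarrow>
    ({u, v} \<in> edges G \<and> s = r) \<or> (u = v \<and> u \<in> verts G \<and> r = - s)"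
  (is "_ \<longleftrightarrow> ?adj u s v r")
proof
  assume "{(u, s), (v, r)} \<in> edges (conflict_graph (neg_graph G))"
  then obtain u' s' v' r' where eq: "{(u, s), (v, r)} = {(u', s'), (v', r')}" and adj: "?adj u' s' v' r'"
    unfolding edges_conflict_neg_graph[OF assms] by blast
  have "?adj v' r' u' s'"
    using adj by (metis insert_commute sign_simps(3))
  with eq adj show "?adj u s v r"
    by (auto simp only: doubleton_eq_iff prod.inject)
qed (unfold edges_conflict_neg_graph[OF assms], blast)

lemma verts_conflict_neg_graph: "verts (conflict_graph (neg_graph G)) = verts G \<times> UNIV"
  by (simp add: conflict_graph_def neg_graph_def UNIV_sign_one)

lemma map_graph_swap_conflict_neg_graph:
  assumes "simple_graph G"
  shows "map_graph prod.swap (conflict_graph (neg_graph G)) = K2 \<box> G"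
proof -
  let ?adj = "\<lambda>u s v r. ({u, v} \<in> edges G \<and> s = r) \<or> (u = v \<and> u \<in> verts G \<and> r = - s)"
  have "edges (map_graph prod.swap (conflict_graph (neg_graph G))) = {{(s, u), (r, v)} | u s v r. ?adj u s v r}"
  proof -
    have "(\<lambda>e. prod.swap ` e) ` {{(u, s), (v, r)} | u s v r. ?adj u s v r} =
        {prod.swap ` {(u, s), (v, r)} | u s v r. ?adj u s v r}"
      by blast
    then show ?thesis
      by (simp only: map_graph_def graph.simps edges_conflict_neg_graph[OF assms] image_insert
          image_empty swap_simp)
  qed
  also have "\<dots> = {{(s, u), (r, v)} | s u r v. ?adj u s v r}"
    by blast
  also have "\<dots> = edges (K2 \<box> G)"
  proof -
    have "(s = r \<and> s \<in> verts K2 \<and> {u, v} \<in> edges G) \<or> (u = v \<and> u \<in> verts G \<and> {s, r} \<in> edges K2)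
        \<longleftrightarrow> ?adj u s v r" for s u r v
      using sign_cases[of s] sign_cases[of r]
      by (auto simp: K2_def doubleton_eq_iff sign_simps)
    then show ?thesis
      by (simp add: cartesian_product_def)
  qed
  finally show ?thesis
    by (intro graph.equality)
      (simp_all add: map_graph_def cartesian_product_def K2_def verts_conflict_neg_graph UNIV_sign_one
        product_swap)
qed

section \<open>Bipartite graphs and odd closed walks\<close>

text \<open>Appending the head adds the closing step, so \<open>length vs\<close> counts the edges
  traversed.\<close>

definition closed_walk :: "'v set set \<Rightarrow> 'v list \<Rightarrow> bool" where
  "closed_walk E vs \<longleftrightarrow> vs \<noteq> [] \<and> successively (\<lambda>u v. {u, v} \<in> E) (vs @ [hd vs])"

lemma closed_walk_nth:
  assumes "closed_walk E vs" "i < length vs"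
  shows "{vs ! i, vs ! (Suc i mod length vs)} \<in> E"
proof -
  have "{(vs @ [hd vs]) ! i, (vs @ [hd vs]) ! Suc i} \<in> E"
    using assms by (auto simp: closed_walk_def successively_conv_nth)
  then show ?thesis
    using assms by (cases "Suc i = length vs") (auto simp: nth_append hd_conv_nth closed_walk_def)
qed

text \<open>A repeated vertex splits an odd closed walk into two shorter ones, one of them odd.\<close>
lemma odd_closed_walk_distinct:
  assumes "closed_walk E vs" "odd (length vs)"
  shows "\<exists>ws. closed_walk E ws \<and> odd (length ws) \<and> distinct ws"
  using assms
proof (induction "length vs" arbitrary: vs rule: less_induct)
  case less
  show ?case
  proof (cases "distinct vs")
    case True
    then show ?thesis using less.prems by blast
  next
    case False
    then obtain xs y ys zs where vs: "vs = xs @ [y] @ ys @ [y] @ zs"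
      using not_distinct_decomp by blast
    \<comment> \<open>The outer walk \<open>xs @ y # zs\<close> starts at \<open>h\<close> as well:
      for \<open>xs = []\<close> the list \<open>vs\<close> itself begins with \<open>y\<close>. Its
      closing step is therefore that of \<open>vs\<close>.\<close>
    define h where "h = hd vs"
    have h: "hd (xs @ y # zs) = h"
      by (cases xs) (simp_all add: h_def vs)
    let ?S = "successively (\<lambda>u v. {u, v} \<in> E)"
    have "?S (xs @ (y # ys) @ (y # zs @ [h]))"
      using less.prems(1) unfolding closed_walk_def h_def[symmetric] by (simp add: vs)
    then have S: "?S xs" "?S (y # ys)" "?S (y # zs @ [h])"
      "xs = [] \<or> {last xs, y} \<in> E" "{last (y # ys), y} \<in> E"
      unfolding successively_append_iff by simp_all
    have "?S ((y # ys) @ [y])"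
      unfolding successively_append_iff using S(2,5) by simp
    then have 1: "closed_walk E (y # ys)"
      by (simp add: closed_walk_def)
    have "?S (xs @ (y # zs @ [h]))"
      unfolding successively_append_iff using S(1,3,4) by simp
    then have 2: "closed_walk E (xs @ y # zs)"
      unfolding closed_walk_def h by simp
    have "odd (length (y # ys)) \<or> odd (length (xs @ y # zs))"
      using less.prems(2) by (auto simp: vs)
    then show ?thesis
      using less.hyps[OF _ 1] less.hyps[OF _ 2] by (auto simp: vs)
  qed
qed

text \<open>The last argument records whether the length of the walk is odd.\<close>
inductive parity_walk :: "'v set set \<Rightarrow> 'v \<Rightarrow> 'v \<Rightarrow> bool \<Rightarrow> bool" for E where
  refl: "parity_walk E u u False"
| step: "{u, v} \<in> E \<Longrightarrow> parity_walk E v w b \<Longrightarrow> parity_walk E u w (\<not> b)"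

lemma parity_walk_trans:
  "parity_walk E u v b \<Longrightarrow> parity_walk E v w c \<Longrightarrow> parity_walk E u w (b \<noteq> c)"
proof (induction rule: parity_walk.induct)
  case (step u v w b)
  then show ?case using parity_walk.step[of u v E _ "b \<noteq> c"] by auto
qed simp

lemma parity_walk_sym: "parity_walk E u v b \<Longrightarrow> parity_walk E v u b"
proof (induction rule: parity_walk.induct)
  case (step u v w b)
  have "parity_walk E v u True"
    using step.hyps(1) parity_walk.step[OF _ parity_walk.refl, of v u E] by (simp add: insert_commute)
  then show ?case using parity_walk_trans[OF step.IH] by fastforce
qed (rule parity_walk.refl)

text \<open>The list omits the end vertex, so its length is the number of steps, and an odd walk
  from \<open>u\<close> back to \<open>u\<close> becomes a \<open>closed_walk\<close>.\<close>

lemma parity_walk_imp_list: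
  "parity_walk E u v b \<Longrightarrow>
    \<exists>vs. successively (\<lambda>u v. {u, v} \<in> E) (vs @ [v]) \<and> hd (vs @ [v]) = u \<and> odd (length vs) = b"
proof (induction rule: parity_walk.induct)
  case (refl u)
  show ?case by (rule exI[of _ "[]"]) simp
next
  case (step u v w b)
  then obtain vs where "successively (\<lambda>u v. {u, v} \<in> E) (vs @ [w])" "hd (vs @ [w]) = v"
    "odd (length vs) = b" by blast
  then show ?case
    using step.hyps by (intro exI[of _ "u # vs"]) (cases vs; auto)
qed

text \<open>Vertices are coloured by the parity of a walk to a root of their component; without odd
  closed walks this parity is well defined and changes along every edge.\<close>

lemma bipartite_if_no_odd_closed_walk:
  assumes edge: "\<And>e. e \<in> edges H \<Longrightarrow> \<exists>u\<in>verts H. \<exists>v\<in>verts H. e = {u, v}"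
    and walk: "\<And>vs. closed_walk (edges H) vs \<Longrightarrow> even (length vs)"
  shows "bipartite H"
proof -
  let ?P = "parity_walk (edges H)"
  have no_odd: "\<not> ?P u u True" for u
  proof
    assume "?P u u True"
    then obtain vs where "successively (\<lambda>u v. {u, v} \<in> edges H) (vs @ [u])" "hd (vs @ [u]) = u"
      "odd (length vs)" using parity_walk_imp_list[of "edges H" u u True] by auto
    moreover from this have "vs \<noteq> []" by auto
    ultimately show False
      using walk[of vs] by (simp add: closed_walk_def)
  qed
  \<comment> \<open>The choice depends only on the set of vertices reachable from \<open>u\<close>,
    so connected vertices get the same root.\<close>
  define root where "root u = (SOME w. \<exists>b. ?P u w b)" for u
  have root: "\<exists>b. ?P u (root u) b" for u
    unfolding root_def by (rule someI[of "\<lambda>w. \<exists>b. ?P u w b" u]) (rule exI, rule parity_walk.refl)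
  have root_eq: "root u = root v" if "?P u v b" for u v b
  proof -
    have "(\<lambda>w. \<exists>b. ?P u w b) = (\<lambda>w. \<exists>b. ?P v w b)"
      by (intro ext iffI; elim exE)
        (rule exI, erule parity_walk_trans[OF that] parity_walk_trans[OF parity_walk_sym[OF that]])+
    then show ?thesis by (simp add: root_def)
  qed
  \<comment> \<open>Otherwise two walks of equal parity to the common root join to an even walk from
    \<open>u\<close> to \<open>v\<close>, which the edge closes to an odd one.\<close>
  have differ: "\<not> ?P v (root v) b" if e: "{u, v} \<in> edges H" and u: "?P u (root u) b" for u v b
  proof
    assume v: "?P v (root v) b"
    have uv: "?P u v True"
      using parity_walk.step[OF e parity_walk.refl] by simp
    have "?P u v False"
      using parity_walk_trans[OF u parity_walk_sym[OF v[folded root_eq[OF uv]]]] by simp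
    then have "?P u u True"
      using parity_walk_trans[OF uv parity_walk_sym] by fastforce
    then show False using no_odd by blast
  qed
  let ?A = "{u \<in> verts H. ?P u (root u) True}"
  show ?thesis
    unfolding bipartite_def
  proof (rule exI[of _ ?A], rule exI[of _ "verts H - ?A"], intro conjI ballI)
    fix e assume e: "e \<in> edges H"
    then obtain u v where uv: "u \<in> verts H" "v \<in> verts H" "e = {u, v}" using edge by blast
    with e have "{u, v} \<in> edges H" "{v, u} \<in> edges H" by (auto simp: insert_commute)
    then have "?P u (root u) True \<noteq> ?P v (root v) True"
      using differ root by (metis (full_types))
    then show "\<exists>a\<in>?A. \<exists>b\<in>verts H - ?A. e = {a, b}"
      using uv by (auto simp: insert_commute)
  qed auto
qed

lemma bipartite_closed_walk_even:
  assumes "bipartite H" and n: "n > 0"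
    and walk: "\<And>i. i < n \<Longrightarrow> {f i, f (Suc i mod n)} \<in> edges H"
  shows "even n"
proof -
  obtain A B where AB: "A \<inter> B = {}" "\<And>e. e \<in> edges H \<Longrightarrow> \<exists>a\<in>A. \<exists>b\<in>B. e = {a, b}"
    using assms(1) unfolding bipartite_def by metis
  have flip: "f (Suc i mod n) \<in> A \<longleftrightarrow> f i \<notin> A" if "i < n" for i
    using AB(1) AB(2)[OF walk[OF that]] by (auto simp: doubleton_eq_iff)
  \<comment> \<open>The index is reduced modulo \<open>n\<close> so that the induction reaches
    \<open>i = n\<close>, where the vertex is \<open>f 0\<close> again and the colours must
    agree.\<close>
  have "f (i mod n) \<in> A \<longleftrightarrow> (even i = (f 0 \<in> A))" if "i \<le> n" for i
    using that
  proof (induction i)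
    case (Suc i)
    then show ?case using flip[of i] by auto
  qed simp
  from this[of n] show ?thesis by auto
qed

section \<open>Balanced vertex sets of the all-negative graph\<close>

lemma sign_minus_one_power: "(- 1 :: sign) ^ n = (if even n then 1 else - 1)"
  by (induction n) (auto simp: sign_simps)

lemma balanced_set_neg_graph_iff:
  assumes G: "simple_graph G" and U: "U \<subseteq> verts G"
  shows "balanced_set (neg_graph G) U \<longleftrightarrow> bipartite (induced_graph G U)"
proof
  let ?S = "induced_sgraph (neg_graph G) U" and ?H = "induced_graph G U"
  assume "balanced_set (neg_graph G) U"
  then have bal: "balanced ?S" by (simp add: balanced_set_def)
  show "bipartite ?H"
  proof (rule bipartite_if_no_odd_closed_walk)
    fix e assume e: "e \<in> edges ?H"
    then obtain u v where "e = {u, v}"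
      using G by (auto simp: induced_graph_def simple_graph_def)
    then show "\<exists>u\<in>verts ?H. \<exists>v\<in>verts ?H. e = {u, v}"
      using e by (auto simp: induced_graph_def)
  next
    fix vs' assume "closed_walk (edges ?H) vs'"
    show "even (length vs')"
    proof (rule ccontr)
      assume "odd (length vs')"
      then obtain vs where vs: "closed_walk (edges ?H) vs" "odd (length vs)" "distinct vs"
        using odd_closed_walk_distinct \<open>closed_walk (edges ?H) vs'\<close> by blast
      define n where "n = length vs"
      define es where "es = map (\<lambda>i. {vs ! i, vs ! (Suc i mod n)}) [0..<n]"
      have e: "{vs ! i, vs ! (Suc i mod n)} \<in> edges G" "vs ! i \<in> U" if "i < n" for i
        using closed_walk_nth[OF vs(1)] that by (auto simp: n_def induced_graph_def)
      \<comment> \<open>Length 1 would be a loop of \<open>G\<close>, and parity excludes length 2,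
        where both consecutive pairs would be the same edge and \<open>es\<close> would not be
        distinct.\<close>
      have "n \<noteq> 1"
        using e(1)[of 0] simple_graph_no_loop[OF G] by auto
      then have n: "n \<ge> 3"
        using vs(2) unfolding n_def[symmetric] by (cases n rule: nat.exhaust; presburger)
      have inj: "vs ! i = vs ! j \<longleftrightarrow> i = j" if "i < n" "j < n" for i j
        using vs(3) that by (simp add: nth_eq_iff_index_eq n_def)
      have "i = j" if ij: "i < n" "j < n"
        and eq: "{vs ! i, vs ! (Suc i mod n)} = {vs ! j, vs ! (Suc j mod n)}" for i j
      proof (rule ccontr)
        assume "i \<noteq> j"
        then have "vs ! i = vs ! (Suc j mod n)" "vs ! (Suc i mod n) = vs ! j"
          using eq inj[OF ij] by (simp_all add: doubleton_eq_iff)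
        \<comment> \<open>Each index is the cyclic successor of the other, which forces
          \<open>n\<close> to divide 2.\<close>
        then have "i = Suc j mod n" "Suc i mod n = j"
          using ij inj[of i "Suc j mod n"] inj[of "Suc i mod n" j] by simp_all
        then show False
          using ij n by (cases "Suc i = n"; cases "Suc j = n") auto
      qed
      moreover have "vs \<noteq> []"
        using n n_def by auto
      ultimately have "distinct es" "vs \<noteq> []"
        by (auto simp: es_def distinct_map inj_on_def)
      then have "is_cycle ?S vs es"
        using e vs n unfolding is_cycle_def es_def n_def[symmetric]
        by (auto simp: induced_sgraph_def neg_graph_def in_set_conv_nth n_def[symmetric])
      then have "prod_list (map (esign ?S) es) = 1"
        using bal by (simp add: balanced_def)
      moreover have "map (esign ?S) es = replicate n (- 1)"
        using e by (intro nth_equalityI) (auto simp: es_def induced_sgraph_def neg_graph_def)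
      ultimately show False
        using vs(2) by (auto simp: sign_minus_one_power n_def[symmetric] sign_simps)
    qed
  qed
next
  let ?S = "induced_sgraph (neg_graph G) U" and ?H = "induced_graph G U"
  assume bip: "bipartite ?H"
  have "prod_list (map (esign ?S) es) = 1" if cyc: "is_cycle ?S vs es" for vs es
  proof -
    define n where "n = length vs"
    have n: "n > 0" "length es = n" and vs: "distinct vs" and es: "set es \<subseteq> sedges ?S"
      and e: "\<And>i. i < n \<Longrightarrow> es ! i = {vs ! i, vs ! (Suc i mod n)}"
      using cyc by (auto simp: is_cycle_def n_def induced_sgraph_def neg_graph_def)
    have mem: "es ! i \<in> edges ?H \<or> (\<exists>v. es ! i = {v})" if "i < n" for i
      using es that n by (auto simp: subset_iff in_set_conv_nth induced_sgraph_def neg_graph_def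
          induced_graph_def; blast)
    show ?thesis
    proof (cases "n = 1")
      case True
      then have "es = [{vs ! 0}]"
        using e[of 0] n by (metis One_nat_def length_0_conv length_Suc_conv less_one mod_by_1
            nth_Cons_0 insert_absorb2 mod_Suc_eq)
      then show ?thesis
        using simple_graph_no_loop[OF G] by (simp add: induced_sgraph_def neg_graph_def)
    next
      case False
      \<comment> \<open>From length 2 on, consecutive vertices differ, so no edge of the cycle is an
        adjoined loop.\<close>
      have e': "es ! i \<in> edges ?H" if "i < n" for i
      proof -
        have "i \<noteq> Suc i mod n"
          using that n False by (cases "Suc i = n") auto
        then have "vs ! i \<noteq> vs ! (Suc i mod n)"
          using vs that n by (simp add: nth_eq_iff_index_eq n_def)
        then show ?thesis
          using mem[OF that] e[OF that] by auto
      qed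
      then have "even n"
        using bipartite_closed_walk_even[OF bip n(1), of "\<lambda>i. vs ! i"] e by auto
      moreover have "map (esign ?S) es = replicate n (- 1)"
        using e' n by (intro nth_equalityI) (auto simp: induced_sgraph_def neg_graph_def induced_graph_def)
      ultimately show ?thesis by (simp add: sign_minus_one_power)
    qed
  qed
  then show "balanced_set (neg_graph G) U"
    using U by (simp add: balanced_set_def balanced_def neg_graph_def)
qed

lemma BSTAB_neg_graph:
  assumes "simple_graph G"
  shows "BSTAB (neg_graph G) = BIP G"
proof -
  have "balanced_set (neg_graph G) B \<longleftrightarrow> B \<subseteq> verts G \<and> bipartite (induced_graph G B)" for B
    using balanced_set_neg_graph_iff[OF assms, of B]
    by (auto simp: balanced_set_def[of _ B] neg_graph_def)
  then show ?thesis by (simp add: BSTAB_def BIP_def)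
qed

section \<open>Clique constraints\<close>

text \<open>For the forward inclusion, the rung at \<open>v\<close> bounds \<open>x $ v\<close> by
  1, and the copies of a clique \<open>K\<close> in the two layers each contribute at most 1 to the
  sum over \<open>K\<close>.\<close>

lemma BQSTAB_neg_graph:
  fixes G :: "'v::finite graph"
  assumes G: "simple_graph G"
  shows "BQSTAB (neg_graph G) =
    {x \<in> vec_on (verts G). (\<forall>v\<in>verts G. 0 \<le> x $ v \<and> x $ v \<le> 1) \<and>
       (\<forall>K. clique G K \<longrightarrow> (\<Sum>v\<in>K. x $ v) \<le> 2)}" (is "_ = ?R")
proof (intro equalityI subsetI)
  let ?C = "conflict_graph (neg_graph G)"
  fix x assume "x \<in> BQSTAB (neg_graph G)"
  then obtain y where y: "y \<in> vec_on (verts ?C)" "\<And>p. p \<in> verts ?C \<Longrightarrow> 0 \<le> y $ p"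
    "\<And>K. clique ?C K \<Longrightarrow> (\<Sum>p\<in>K. y $ p) \<le> 1" and x: "x = pair_sum y"
    by (auto simp: BQSTAB_def QSTAB_def)
  have "x $ v \<le> 1" if "v \<in> verts G" for v
    using y(3)[of "{(v, 1), (v, - 1)}"] that
    by (auto simp: clique_def verts_conflict_neg_graph conflict_neg_graph_adj[OF G] x pair_sum_def
        sign_simps)
  moreover have "(\<Sum>v\<in>K. x $ v) \<le> 2" if K: "clique G K" for K
  proof -
    have "(\<Sum>v\<in>K. y $ (v, s)) \<le> 1" for s
    proof -
      have "clique ?C (K \<times> {s})"
        using K by (auto simp: clique_def verts_conflict_neg_graph conflict_neg_graph_adj[OF G])
      then show ?thesis
        using y(3)[of "K \<times> {s}"] sum.cartesian_product[of "\<lambda>v s. y $ (v, s)" "{s}" K] by simp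
    qed
    from this[of 1] this[of "- 1"] show ?thesis
      by (simp add: x pair_sum_def sum.distrib)
  qed
  ultimately show "x \<in> ?R"
    using y(1,2) by (auto simp: x pair_sum_def vec_on_def verts_conflict_neg_graph)
next
  let ?C = "conflict_graph (neg_graph G)"
  fix x assume x: "x \<in> ?R"
  define y :: "real ^ ('v \<times> sign)" where "y = (\<chi> p. x $ fst p / 2)"
  have "(\<Sum>p\<in>L. y $ p) \<le> 1" if L: "clique ?C L" for L
  proof (cases "\<exists>s. L \<subseteq> UNIV \<times> {s}")
    case True
    then obtain s where s: "L \<subseteq> UNIV \<times> {s}" by blast
    have "clique G (fst ` L)"
      using L s unfolding clique_def verts_conflict_neg_graph
      by (fastforce simp: conflict_neg_graph_adj[OF G])
    then have "(\<Sum>v\<in>fst ` L. x $ v) \<le> 2"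
      using x by blast
    moreover have "inj_on fst L"
      using s by (auto simp: inj_on_def)
    ultimately show ?thesis
      by (simp add: y_def sum.reindex sum_divide_distrib[symmetric])
  next
    case False
    then obtain u s v r where "(u, s) \<in> L" "(v, r) \<in> L" "s \<noteq> r"
      by (metis SigmaI UNIV_I singletonI subsetI surj_pair)
    have adj: "(a = b \<and> a \<in> verts G \<and> d = - c) \<or> c = d" if "(a, c) \<in> L" "(b, d) \<in> L" for a b c d
      using L that conflict_neg_graph_adj[OF G, of a c b d] unfolding clique_def by blast
    have uv: "u = v" "u \<in> verts G"
      using adj[OF \<open>(u, s) \<in> L\<close> \<open>(v, r) \<in> L\<close>] \<open>s \<noteq> r\<close> by auto
    \<comment> \<open>The sign of any vertex of \<open>L\<close> differs from \<open>s\<close> or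
      from \<open>r\<close>, so that vertex is joined by a rung to \<open>(u, s)\<close> or
      \<open>(u, r)\<close> and lies over \<open>u\<close>.\<close>
    have "L \<subseteq> {(u, 1), (u, - 1)}"
    proof
      fix p assume p: "p \<in> L"
      obtain a c where ac: "p = (a, c)" by fastforce
      have "a = u"
        using adj[of a c u s] adj[of a c v r] p ac uv \<open>(u, s) \<in> L\<close> \<open>(v, r) \<in> L\<close> \<open>s \<noteq> r\<close> by auto
      then show "p \<in> {(u, 1), (u, - 1)}"
        using sign_cases[of c] ac by auto
    qed
    then have "(\<Sum>p\<in>L. y $ p) \<le> (\<Sum>p\<in>{(u, 1), (u, - 1)}. y $ p)"
      using x uv by (intro sum_mono2) (auto simp: y_def)
    also have "\<dots> = x $ u"
      by (simp add: y_def sign_simps)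
    also have "\<dots> \<le> 1" using x uv by auto
    finally show ?thesis .
  qed
  then have "y \<in> QSTAB ?C"
    using x by (auto simp: QSTAB_def vec_on_def y_def verts_conflict_neg_graph)
  moreover have "x = pair_sum y"
    by (simp add: pair_sum_def y_def vec_eq_iff)
  ultimately show "x \<in> BQSTAB (neg_graph G)"
    by (auto simp: BQSTAB_def)
qed

section \<open>Theta number\<close>

lemma inner_mat_vec_sum:
  "z \<bullet> (M *v w) = (\<Sum>u\<in>UNIV. \<Sum>v\<in>UNIV. z $ u * M $ u $ v * w $ v)"
  for M :: "real ^ 'n::finite ^ 'n"
  by (simp add: inner_vec_def matrix_vector_mult_def sum_distrib_left mult.assoc)

lemma ones_inner_mat: "(\<chi> u v. 1) \<bullet> Z = 1 \<bullet> (Z *v 1)" for Z :: "real ^ 'n::finite ^ 'n"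
  unfolding inner_mat_vec_sum by (simp add: inner_vec_def)

lemma psd_expand:
  fixes M :: "real ^ 'n::finite ^ 'n"
  assumes "transpose M = M"
  shows "(x + c *\<^sub>R y) \<bullet> (M *v (x + c *\<^sub>R y)) = x \<bullet> (M *v x) + 2 * c * (y \<bullet> (M *v x)) + c\<^sup>2 * (y \<bullet> (M *v y))"
proof -
  have "x \<bullet> (M *v y) = y \<bullet> (M *v x)"
    using dot_lmul_matrix[of x M y] assms by (simp add: inner_commute flip: transpose_matrix_vector)
  then show ?thesis
    by (simp add: matrix_vector_right_distrib matrix_vector_mult_scaleR inner_add_left inner_add_right
        algebra_simps power2_eq_square)
qed

lemma axis_mat_axis: "axis u 1 \<bullet> (M *v axis v 1) = M $ u $ v" for M :: "real ^ 'n::finite ^ 'n"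
  by (simp add: inner_axis' matrix_vector_mult_basis column_def)

lemma psd_diag_nonneg: "psd M \<Longrightarrow> 0 \<le> M $ u $ u"
  unfolding psd_def by (metis axis_mat_axis)

text \<open>The form is tested at the sum and the difference of two basis vectors.\<close>

lemma psd_entry_bound:
  assumes "psd M"
  shows "\<bar>M $ u $ v\<bar> \<le> (M $ u $ u + M $ v $ v) / 2"
proof -
  have "transpose M = M" "\<And>z. 0 \<le> z \<bullet> (M *v z)"
    using assms by (auto simp: psd_def)
  then have "0 \<le> M $ v $ v + 2 * c * M $ u $ v + c\<^sup>2 * M $ u $ u" for c
    using psd_expand[of M "axis v 1" c "axis u 1"] by (metis axis_mat_axis)
  from this[of 1] this[of "- 1"] show ?thesis by simp
qed

text \<open>Along \<open>x + c *\<^sub>R axis u 1\<close> the form is affine in \<open>c\<close>,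
  because its quadratic coefficient is the vanishing diagonal entry. Nonnegativity for all
  \<open>c\<close> forces the slope to vanish.\<close>

lemma psd_mult_vec_eq_0:
  assumes M: "psd M" and 0: "M $ u $ u = 0"
  shows "(M *v x) $ u = 0"
proof -
  let ?b = "(M *v x) $ u" and ?m = "x \<bullet> (M *v x)"
  have "transpose M = M" and nn: "\<And>z. 0 \<le> z \<bullet> (M *v z)"
    using M by (auto simp: psd_def)
  then have *: "0 \<le> ?m + 2 * c * ?b" for c
    using psd_expand[of M x c "axis u 1"] nn[of "x + c *\<^sub>R axis u 1"] axis_mat_axis[of u M u] 0
    by (simp add: inner_axis')
  show ?thesis
  proof (rule ccontr)
    assume "?b \<noteq> 0"
    \<comment> \<open>This \<open>c\<close> makes the affine function equal to -1.\<close>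
    then show False
      using *[of "- (?m + 1) / (2 * ?b)"] by (simp add: field_simps)
  qed
qed

section \<open>Attainment of the maximum defining the theta number\<close>

definition theta_feasible :: "'v::finite graph \<Rightarrow> (real ^ 'v ^ 'v) set" where
  "theta_feasible H = {Z \<in> mat_on (verts H). psd Z \<and> trace Z = 1 \<and>
     (\<forall>u v. {u, v} \<in> edges H \<longrightarrow> Z $ u $ v = 0)}"

lemma lovasz_theta_alt:
  "lovasz_theta H = (THE m. is_max ((\<lambda>Z. 1 \<bullet> (Z *v 1)) ` theta_feasible H) m)"
proof -
  have "{(\<chi> u v. 1) \<bullet> Z | Z. Z \<in> mat_on (verts H) \<and> psd Z \<and> trace Z = 1 \<and>
        (\<forall>u v. {u, v} \<in> edges H \<longrightarrow> Z $ u $ v = 0)} = (\<lambda>Z. 1 \<bullet> (Z *v 1)) ` theta_feasible H"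
    unfolding ones_inner_mat theta_feasible_def by blast
  then show ?thesis by (simp add: lovasz_theta_def)
qed

lemma is_max_unique: "is_max S m \<Longrightarrow> is_max S n \<Longrightarrow> m = n"
  by (auto simp: is_max_def intro: antisym)

text \<open>The diagonal is nonnegative with sum 1, so diagonal entries are at most 1, and
  \<open>psd_entry_bound\<close> controls the others. For closedness, positive semidefiniteness is
  an intersection of closed half-spaces, one for each \<open>z\<close>.\<close>

lemma compact_theta_feasible: "compact (theta_feasible (H :: 'v::finite graph))"
  unfolding compact_eq_bounded_closed
proof
  have entry: "\<bar>Z $ u $ v\<bar> \<le> 1" if "Z \<in> theta_feasible H" for Z u v
  proof -
    have Z: "psd Z" "trace Z = 1" using that by (auto simp: theta_feasible_def)
    have "Z $ w $ w \<le> 1" for w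
      using member_le_sum[of w UNIV "\<lambda>w. Z $ w $ w"] psd_diag_nonneg[OF Z(1)] Z(2)
      by (simp add: trace_def)
    from this[of u] this[of v] psd_entry_bound[OF Z(1), of u v] show ?thesis by simp
  qed
  have "norm Z \<le> (\<Sum>u\<in>(UNIV :: 'v set). \<Sum>v\<in>(UNIV :: 'v set). 1)" if "Z \<in> theta_feasible H" for Z
  proof -
    have "norm Z \<le> (\<Sum>u\<in>UNIV. norm (Z $ u))"
      unfolding norm_vec_def[of Z] by (rule L2_set_le_sum) simp
    also have "\<dots> \<le> (\<Sum>u\<in>(UNIV :: 'v set). \<Sum>v\<in>(UNIV :: 'v set). 1)"
      by (intro sum_mono order_trans[OF norm_le_l1_cart]) (use entry[OF that] in auto)
    finally show ?thesis .
  qed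
  then show "bounded (theta_feasible H)"
    by (auto intro: boundedI)
next
  have eq: "theta_feasible H =
      (\<Inter>u v. {Z. u \<notin> verts H \<or> v \<notin> verts H \<or> {u, v} \<in> edges H \<longrightarrow> Z $ u $ v = 0}) \<inter>
      (\<Inter>u v. {Z. Z $ v $ u = Z $ u $ v}) \<inter> (\<Inter>z. {Z. 0 \<le> z \<bullet> (Z *v z)}) \<inter> {Z. trace Z = 1}"
    by (auto simp: theta_feasible_def mat_on_def psd_def transpose_def vec_eq_iff)
  show "closed (theta_feasible H)"
    unfolding eq inner_mat_vec_sum trace_def
    by (intro closed_Int closed_INT ballI closed_Collect_imp closed_Collect_eq closed_Collect_le
        continuous_intros open_Collect_const)
qed

lemma axis_outer_qform:
  "z \<bullet> ((\<chi> i j. axis v 1 $ i * axis v 1 $ j) *v z) = (z $ v)\<^sup>2" for z :: "real ^ 'n::finite"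
proof -
  have "z \<bullet> ((\<chi> i j. axis v 1 $ i * axis v 1 $ j) *v z) =
      (\<Sum>i\<in>UNIV. z $ i * axis v 1 $ i) * (\<Sum>j\<in>UNIV. z $ j * axis v 1 $ j)"
    unfolding inner_mat_vec_sum sum_product by (simp add: mult_ac)
  also have "(\<Sum>i\<in>UNIV. z $ i * axis v 1 $ i) = z $ v"
    using inner_axis[of z v 1] by (simp add: inner_vec_def)
  finally show ?thesis by (simp add: power2_eq_square)
qed

text \<open>The only nonzero entry is on the diagonal, while edges of a simple graph constrain only
  off-diagonal entries.\<close>

lemma theta_feasible_axis:
  assumes H: "simple_graph H" and v: "v \<in> verts H"
  shows "(\<chi> i j. axis v 1 $ i * axis v 1 $ j) \<in> theta_feasible H" (is "?Z \<in> _")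
proof -
  have "psd ?Z"
    by (simp add: psd_def axis_outer_qform transpose_def vec_eq_iff mult.commute)
  moreover have "trace ?Z = axis v 1 \<bullet> axis v (1 :: real)"
    by (simp add: trace_def inner_vec_def)
  then have "trace ?Z = 1"
    by (simp add: inner_axis_axis)
  ultimately show ?thesis
    using v simple_graph_no_loop[OF H] by (auto simp: theta_feasible_def mat_on_def axis_def)
qed

text \<open>A vertex makes the feasible set nonempty, compactness gives a maximum, and its
  uniqueness makes the \<open>THE\<close> in the definition meaningful.\<close>

lemma is_max_lovasz_theta:
  assumes "simple_graph H" "verts H \<noteq> {}"
  shows "is_max ((\<lambda>Z. 1 \<bullet> (Z *v 1)) ` theta_feasible H) (lovasz_theta H)"
proof -
  have "theta_feasible H \<noteq> {}"
    using assms theta_feasible_axis by blast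
  moreover have "continuous_on (theta_feasible H) (\<lambda>Z. 1 \<bullet> (Z *v 1))"
    unfolding inner_mat_vec_sum by (intro continuous_intros)
  ultimately obtain Z where "Z \<in> theta_feasible H"
    "\<forall>Y\<in>theta_feasible H. 1 \<bullet> (Y *v 1) \<le> 1 \<bullet> (Z *v 1)"
    using continuous_attains_sup[OF compact_theta_feasible] by blast
  then have "is_max ((\<lambda>Z. 1 \<bullet> (Z *v 1)) ` theta_feasible H) (1 \<bullet> (Z *v 1))"
    by (auto simp: is_max_def)
  then show ?thesis
    unfolding lovasz_theta_alt by (rule theI) (rule is_max_unique[OF _ \<open>is_max _ _\<close>])
qed

text \<open>This positivity permits division by the theta number and settles the case of a
  nonpositive coordinate sum.\<close>

lemma lovasz_theta_ge_1:
  assumes "simple_graph H" "verts H \<noteq> {}"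
  shows "1 \<le> lovasz_theta H"
proof -
  obtain v where v: "v \<in> verts H" using assms by blast
  have "1 \<bullet> ((\<chi> i j. axis v (1 :: real) $ i * axis v 1 $ j) *v 1) = 1"
    by (simp add: axis_outer_qform)
  then show ?thesis
    using is_max_lovasz_theta[OF assms] theta_feasible_axis[OF assms(1) v]
    unfolding is_max_def by (metis image_eqI)
qed

section \<open>Linear optimisation over TH and the theta number\<close>

lemma bordered_qform:
  "w \<bullet> (bordered x X *v w) =
    (w $ None)\<^sup>2 + 2 * w $ None * ((\<chi> v. w $ Some v) \<bullet> x) + (\<chi> v. w $ Some v) \<bullet> (X *v (\<chi> v. w $ Some v))"
proof -
  have opt: "(\<Sum>i\<in>UNIV. f i) = f None + (\<Sum>v\<in>UNIV. f (Some v))" for f :: "'a option \<Rightarrow> real"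
    by (simp add: UNIV_option_conv sum.reindex)
  show ?thesis
    unfolding inner_mat_vec_sum opt
    by (simp add: bordered_def inner_vec_def sum.distrib sum_distrib_left power2_eq_square algebra_simps)
qed

lemma transpose_bordered: "transpose X = X \<Longrightarrow> transpose (bordered x X) = bordered x X"
  by (auto simp: transpose_def bordered_def vec_eq_iff split: option.splits)

lemma TH_sum_le_lovasz_theta:
  fixes H :: "'v::finite graph"
  assumes H: "simple_graph H" "verts H \<noteq> {}" and x: "x \<in> TH H"
  shows "(\<Sum>v\<in>UNIV. x $ v) \<le> lovasz_theta H"
proof -
  define s where "s = (\<Sum>v\<in>UNIV. x $ v)"
  obtain X where X: "X \<in> mat_on (verts H)" "transpose X = X" "psd (bordered x X)"
    "\<forall>v\<in>verts H. X $ v $ v = x $ v" "\<forall>u v. {u, v} \<in> edges H \<longrightarrow> X $ u $ v = 0"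
    and xv: "x \<in> vec_on (verts H)"
    using x by (auto simp: TH_def)
  have diag: "X $ v $ v = x $ v" for v
    using X(1,4) xv by (cases "v \<in> verts H") (auto simp: mat_on_def vec_on_def)
  have q: "0 \<le> t\<^sup>2 + 2 * t * (z \<bullet> x) + z \<bullet> (X *v z)" for t z
  proof -
    let ?w = "(\<chi> i. case i of None \<Rightarrow> t | Some v \<Rightarrow> z $ v) :: real ^ 'v option"
    have "0 \<le> ?w \<bullet> (bordered x X *v ?w)" using X(3) by (simp add: psd_def)
    then show ?thesis by (simp add: bordered_qform)
  qed
  show ?thesis
  proof (cases "s > 0")
    case False
    then show ?thesis using lovasz_theta_ge_1[OF H] by (simp add: s_def)
  next
    case True
    let ?Z = "(1 / s) *\<^sub>R X"
    have Zq: "z \<bullet> (?Z *v z) = (z \<bullet> (X *v z)) / s" for z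
      by (simp add: inner_mat_vec_sum sum_divide_distrib)
    have "psd ?Z"
      using X(2) q[of 0] True by (auto simp: psd_def Zq transpose_scalar) 
    moreover have "trace ?Z = 1"
      using True by (simp add: trace_def diag s_def sum_divide_distrib[symmetric])
    ultimately have "?Z \<in> theta_feasible H"
      using X(1,5) by (auto simp: theta_feasible_def mat_on_def)
    then have "1 \<bullet> (X *v 1) / s \<le> lovasz_theta H"
      using is_max_lovasz_theta[OF H] unfolding is_max_def Zq[symmetric] by blast
    \<comment> \<open>The bordered form is evaluated at border coordinate \<open>- s\<close> and all
      other coordinates 1.\<close>
    moreover have "s\<^sup>2 \<le> 1 \<bullet> (X *v 1)"
    proof -
      have "1 \<bullet> x = s" by (simp add: inner_vec_def s_def)
      then show ?thesis using q[of "- s" 1] by (simp add: power2_eq_square)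
    qed
    then have "s \<le> 1 \<bullet> (X *v 1) / s"
      using True by (simp add: pos_le_divide_eq power2_eq_square)
    ultimately show ?thesis by (simp add: s_def)
  qed
qed

text \<open>If \<open>Z\<close> is the Gram matrix of vectors \<open>z\<^sub>u\<close> and \<open>d\<close> is the unit vector along \<open>\<Sum>z\<^sub>u\<close>, then
  \<open>x\<^sub>u\<close> below is \<open>(d \<bullet> z\<^sub>u)\<^sup>2 / |z\<^sub>u|\<^sup>2\<close>, and \<open>X\<close> is the Gram matrix of the projections of \<open>d\<close> onto
  the lines spanned by the \<open>z\<^sub>u\<close>. Division by zero gives the intended value \<open>0\<close> when \<open>Z\<^sub>u\<^sub>u = 0\<close>.\<close>
lemma lovasz_theta_le_TH_sum:
  fixes H :: "'v::finite graph"
  assumes H: "simple_graph H" "verts H \<noteq> {}"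
  shows "\<exists>x\<in>TH H. lovasz_theta H \<le> (\<Sum>v\<in>UNIV. x $ v)"
proof -
  define m where "m = lovasz_theta H"
  have m: "m > 0" using lovasz_theta_ge_1[OF H] by (simp add: m_def)
  obtain Z where Z: "Z \<in> mat_on (verts H)" "psd Z" "trace Z = 1"
    "\<And>u v. {u, v} \<in> edges H \<Longrightarrow> Z $ u $ v = 0" and mZ: "m = 1 \<bullet> (Z *v 1)"
    using is_max_lovasz_theta[OF H] by (auto simp: is_max_def theta_feasible_def m_def)
  have sym: "transpose Z = Z" and nn: "\<And>z. 0 \<le> z \<bullet> (Z *v z)"
    using Z(2) by (auto simp: psd_def)
  define b where "b = Z *v 1"
  \<comment> \<open>In Gram terms, with \<open>d\<close> the sum of the vectors divided by
    \<open>sqrt m\<close>, the product of \<open>d\<close> with the vector of \<open>u\<close> is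
    \<open>b $ u / sqrt m\<close>, so \<open>a $ u\<close> is the coefficient of the projection of
    \<open>d\<close> onto its line.\<close>
  define a where "a = (\<chi> u. b $ u / (sqrt m * Z $ u $ u))"
  define x where "x = (\<chi> u. (b $ u)\<^sup>2 / (m * Z $ u $ u))"
  define X where "X = (\<chi> u v. a $ u * a $ v * Z $ u $ v)"
  have b0: "b $ u = 0" if "Z $ u $ u = 0" for u
    using psd_mult_vec_eq_0[OF Z(2) that] by (simp add: b_def)
  have xa: "x $ u = a $ u * b $ u / sqrt m" for u
    using m by (simp add: x_def a_def power2_eq_square)
  have Xdiag: "X $ u $ u = x $ u" for u
    using m b0[of u] by (cases "Z $ u $ u = 0") (simp_all add: x_def X_def a_def power2_eq_square)
  have Xsym: "transpose X = X"
    using sym by (simp add: transpose_def X_def vec_eq_iff mult.commute)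
  have "0 \<le> w \<bullet> (bordered x X *v w)" for w
  proof -
    define y where "y = (\<chi> u. a $ u * w $ Some u)"
    let ?t = "w $ None"
    have 1: "(\<chi> v. w $ Some v) \<bullet> (X *v (\<chi> v. w $ Some v)) = y \<bullet> (Z *v y)"
      unfolding inner_mat_vec_sum by (simp add: X_def y_def mult_ac)
    have 2: "(\<chi> v. w $ Some v) \<bullet> x = (y \<bullet> b) / sqrt m"
      by (simp add: inner_vec_def xa y_def sum_divide_distrib mult_ac)
    \<comment> \<open>The bordered form is the squared norm of \<open>?t\<close> times
      \<open>d\<close> plus a combination of the Gram vectors; since \<open>d\<close> is itself such
      a combination, it is a value of the form of \<open>Z\<close>.\<close>
    have "0 \<le> (y + (?t / sqrt m) *\<^sub>R 1) \<bullet> (Z *v (y + (?t / sqrt m) *\<^sub>R 1))" by (rule nn)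
    also have "\<dots> = y \<bullet> (Z *v y) + 2 * (?t / sqrt m) * (1 \<bullet> (Z *v y)) + (?t / sqrt m)\<^sup>2 * m"
      unfolding psd_expand[OF sym] mZ ..
    also have "1 \<bullet> (Z *v y) = y \<bullet> b"
      using dot_lmul_matrix[of 1 Z y] sym by (simp add: b_def inner_commute flip: transpose_matrix_vector)
    also have "(?t / sqrt m)\<^sup>2 * m = ?t\<^sup>2"
      using m by (simp add: power_divide)
    finally show ?thesis
      unfolding bordered_qform 1 2 by (simp add: algebra_simps)
  qed
  then have "psd (bordered x X)"
    using transpose_bordered[OF Xsym] by (simp add: psd_def)
  moreover have "x \<in> vec_on (verts H)" "X \<in> mat_on (verts H)"
    using Z(1) by (auto simp: vec_on_def mat_on_def x_def X_def)
  ultimately have "x \<in> TH H"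
    using Xdiag Xsym Z(4) by (auto simp: TH_def X_def intro!: bexI[of _ X])
  moreover have "m \<le> (\<Sum>v\<in>UNIV. x $ v)"
  proof -
    \<comment> \<open>the tangent-line form of Cauchy-Schwarz\<close>
    have "2 * b $ u - m * Z $ u $ u \<le> x $ u" for u
    proof (cases "Z $ u $ u = 0")
      case True
      then show ?thesis using b0 by (simp add: x_def)
    next
      case False
      then have "Z $ u $ u > 0" using psd_diag_nonneg[OF Z(2), of u] by simp
      then have p: "m * Z $ u $ u > 0" using m by simp
      have "0 \<le> (b $ u - m * Z $ u $ u)\<^sup>2 / (m * Z $ u $ u)" using p by simp
      also have "\<dots> = x $ u - 2 * b $ u + m * Z $ u $ u"
        using m False by (simp add: x_def field_simps power2_eq_square)
      finally show ?thesis by simp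
    qed
    then have "(\<Sum>u\<in>UNIV. 2 * b $ u - m * Z $ u $ u) \<le> (\<Sum>u\<in>UNIV. x $ u)"
      by (rule sum_mono)
    \<comment> \<open>The entries of \<open>b\<close> sum to \<open>m\<close>, and \<open>Z\<close>
      has trace 1.\<close>
    moreover have "(\<Sum>u\<in>UNIV. 2 * b $ u - m * Z $ u $ u) = 2 * m - m"
      using Z(3) by (simp add: sum_subtractf sum_distrib_left[symmetric] trace_def mZ b_def inner_vec_def)
    ultimately show ?thesis by simp
  qed
  ultimately show ?thesis by (auto simp: m_def)
qed

lemma is_max_TH_lovasz_theta:
  assumes "simple_graph H" "verts H \<noteq> {}"
  shows "is_max ((\<lambda>x. \<Sum>v\<in>UNIV. x $ v) ` TH H) (lovasz_theta H)"
  using TH_sum_le_lovasz_theta[OF assms] lovasz_theta_le_TH_sum[OF assms]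
  unfolding is_max_def by (auto simp: image_iff intro: antisym)

section \<open>Invariance of the theta number under relabelling\<close>

lemma theta_feasible_map_graph:
  fixes f :: "'a::finite \<Rightarrow> 'b::finite"
  assumes f: "bij f" and Z: "Z \<in> theta_feasible (map_graph f H)"
  shows "(\<chi> u v. Z $ f u $ f v) \<in> theta_feasible H" (is "?Y \<in> _")
    and "1 \<bullet> ((\<chi> u v. Z $ f u $ f v) *v 1) = 1 \<bullet> (Z *v 1)"
proof -
  have re: "(\<Sum>u\<in>UNIV. h (f u)) = (\<Sum>p\<in>UNIV. h p)" for h :: "'b \<Rightarrow> real"
    by (rule sum.reindex_bij_betw[OF f])
  \<comment> \<open>Permuting rows and columns simultaneously amounts to permuting the test vector,
    which preserves nonnegativity.\<close>
  have q: "z \<bullet> (?Y *v z) = (\<chi> p. z $ inv f p) \<bullet> (Z *v (\<chi> p. z $ inv f p))" for z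
    unfolding inner_mat_vec_sum re[symmetric] using f by (simp add: bij_is_inj)
  show "1 \<bullet> (?Y *v 1) = 1 \<bullet> (Z *v 1)"
    unfolding inner_mat_vec_sum re[symmetric] by simp
  have "psd ?Y"
    using Z by (auto simp: psd_def q theta_feasible_def transpose_def vec_eq_iff)
  moreover have "trace ?Y = 1"
    using Z re[of "\<lambda>p. Z $ p $ p"] by (simp add: trace_def theta_feasible_def)
  moreover have "Z $ f u $ f v = 0" if "{u, v} \<in> edges H" for u v
  proof -
    have "{f u, f v} \<in> edges (map_graph f H)"
      using imageI[OF that, of "\<lambda>e. f ` e"] by (simp add: map_graph_def)
    then show ?thesis using Z by (simp add: theta_feasible_def)
  qed
  moreover have "?Y \<in> mat_on (verts H)"
    using Z f by (auto simp: theta_feasible_def mat_on_def map_graph_def inj_image_mem_iff bij_is_inj)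
  ultimately show "?Y \<in> theta_feasible H"
    by (simp add: theta_feasible_def)
qed

text \<open>Pulling matrices back along \<open>f\<close> and along \<open>inv f\<close> shows that
  both graphs have the same set of objective values.\<close>

lemma lovasz_theta_map_graph:
  fixes f :: "'a::finite \<Rightarrow> 'b::finite"
  assumes f: "bij f"
  shows "lovasz_theta (map_graph f H) = lovasz_theta H"
proof -
  let ?V = "\<lambda>H. (\<lambda>Z. 1 \<bullet> (Z *v 1)) ` theta_feasible H"
  have "map_graph (inv f) (map_graph f H) = H"
    using f by (simp add: map_graph_def image_comp comp_def bij_is_inj)
  then have "?V H \<subseteq> ?V (map_graph f H)"
    using theta_feasible_map_graph[OF bij_imp_bij_inv[OF f], of _ "map_graph f H"] by (auto simp: image_iff) metis
  moreover have "?V (map_graph f H) \<subseteq> ?V H"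
    using theta_feasible_map_graph[OF f, of _ H] by (auto simp: image_iff) metis
  ultimately show ?thesis
    by (simp add: lovasz_theta_alt)
qed

lemma sum_pair_sum: "(\<Sum>v\<in>UNIV. pair_sum y $ v) = (\<Sum>p\<in>UNIV. y $ p)"
proof -
  have "(\<Sum>p\<in>UNIV. y $ p) = (\<Sum>v\<in>UNIV. \<Sum>s\<in>UNIV. y $ (v, s))"
    by (simp add: sum.cartesian_product)
  also have "\<dots> = (\<Sum>v\<in>UNIV. pair_sum y $ v)"
    unfolding UNIV_sign_one by (simp add: pair_sum_def sign_simps)
  finally show ?thesis ..
qed

text \<open>Both sums run over the same coordinates of \<open>y\<close>, since points of TH vanish
  off the vertex set; the swap of factors carries the theta number to the product.\<close>

lemma is_max_BTH_neg_graph: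
  assumes G: "simple_graph G" and ne: "verts G \<noteq> {}"
  shows "is_max {(\<Sum>v\<in>verts G. x $ v) | x. x \<in> BTH (neg_graph G)} (lovasz_theta (K2 \<box> G))"
proof -
  let ?C = "conflict_graph (neg_graph G)"
  have "(\<Sum>v\<in>verts G. pair_sum y $ v) = (\<Sum>p\<in>UNIV. y $ p)" if "y \<in> TH ?C" for y
  proof -
    have "(\<Sum>v\<in>verts G. pair_sum y $ v) = (\<Sum>v\<in>UNIV. pair_sum y $ v)"
      using that by (intro sum.mono_neutral_left)
        (auto simp: TH_def vec_on_def verts_conflict_neg_graph pair_sum_def)
    then show ?thesis by (simp add: sum_pair_sum)
  qed
  then have "{(\<Sum>v\<in>verts G. x $ v) | x. x \<in> BTH (neg_graph G)} = (\<lambda>y. \<Sum>p\<in>UNIV. y $ p) ` TH ?C"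
    unfolding BTH_def by force
  moreover have "lovasz_theta (K2 \<box> G) = lovasz_theta ?C"
    unfolding map_graph_swap_conflict_neg_graph[OF G, symmetric]
    by (rule lovasz_theta_map_graph) simp
  moreover have "simple_graph ?C" "verts ?C \<noteq> {}"
    using simple_graph_conflict_graph[OF signed_graph_neg_graph[OF G]] ne
    by (auto simp: verts_conflict_neg_graph)
  ultimately show ?thesis
    using is_max_TH_lovasz_theta by metis
qed

theorem proposition7p6:
  fixes G :: "'v::finite graph"
  assumes "simple_graph G"
  shows "BSTAB (neg_graph G) = BIP G
    \<and> map_graph prod.swap (conflict_graph (neg_graph G)) = K2 \<box> G
    \<and> (verts G \<noteq> {} \<longrightarrow>
         is_max {(\<Sum>v\<in>verts G. x $ v) | x. x \<in> BTH (neg_graph G)} (lovasz_theta (K2 \<box> G)))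
    \<and> BQSTAB (neg_graph G) =
        {x \<in> vec_on (verts G). (\<forall>v\<in>verts G. 0 \<le> x $ v \<and> x $ v \<le> 1) \<and>
           (\<forall>K. clique G K \<longrightarrow> (\<Sum>v\<in>K. x $ v) \<le> 2)}"
  using BSTAB_neg_graph[OF assms] map_graph_swap_conflict_neg_graph[OF assms]
    is_max_BTH_neg_graph[OF assms] BQSTAB_neg_graph[OF assms] by blast

end
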